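(* Assume that for every $\xi$ the operator $F_\xi$ is $L_\xi$-Lipschitz with $L_\xi>0$, and that there is a (possibly negative) $\mu_\xi\in\mathbb{R}$ with $\langle F_\xi(x)-F_\xi(x^* ),x-x^*\rangle\ge\mu_\xi\|x-x^*\|^2$ for all $x\in\mathbb{R}^d$. Let $\gamma_{2,\xi^k}=\alpha\gamma_{1,\xi^k}$ with $0<\alpha\le\frac14$, where $\gamma_{1,\xi}>0$ satisfies $$\mathbb{E}_{\xi}[\gamma_{1,\xi}F_{\xi}(x^* )]=0,\qquad \mathbb{E}_{\xi}\left[\gamma_{1,\xi}\mu_{\xi}\left(\mathbf{1}_{\{\mu_{\xi}\ge0\}}+4\cdot\mathbf{1}_{\{\mu_{\xi}<0\}}\right)\right]\ge0,\qquad \gamma_{1,\xi}\le\frac{1}{4|\mu_{\xi}|+\sqrt2 L_{\xi}}.$$ Let $$\rho=\frac{\alpha}{2}\mathbb{E}_{\xi}\left[\gamma_{1,\xi}\mu_{\xi}\left(\mathbf{1}_{\{\mu_{\xi}\ge0\}}+4\cdot\mathbf{1}_{\{\mu_{\xi}<0\}}\right)\right],\qquad \sigma_{AS}^2=\mathbb{E}_\xi\left[\gamma_{1,\xi}^2\|F_\xi(x^* )\|^2\right],$$ and assume $\rho>0$. Then for all $K\ge 0$ the iterates of S-SEG satisfy $$\mathbb{E}\left[\|x^K-x^*\|^2\right]\le(1-\rho)^K\|x^0-x^*\|^2+\frac{3\alpha(4\alpha+1)\sigma_{AS}^2}{2\rho}.$$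
   Context: $F:\mathbb{R}^d\to\mathbb{R}^d$ is an operator, $x^*\in\mathbb{R}^d$ satisfies $F(x^* )=0$, $\|\cdot\|$ is the Euclidean norm. $F_\xi:\mathbb{R}^d\to\mathbb{R}^d$ are stochastic realizations indexed by a random variable $\xi$; $\xi^0,\xi^1,\dots$ are independent copies of $\xi$. $\mathbf{1}_{\{\cdot\}}$ is the indicator of a condition. Same-sample stochastic extragradient (S-SEG), started at a deterministic $x^0\in\mathbb{R}^d$, is $$x^{k+1}=x^k-\gamma_{2,\xi^k}F_{\xi^k}\left(x^k-\gamma_{1,\xi^k}F_{\xi^k}(x^k)\right),\quad k\ge0,$$ where the same sample $\xi^k$ is used twice and the stepsizes may depend on the sample. *)

theory Defs
  imports "HOL-Probability.Probability"
begin

(* S-SEG along one realisation \<xi> of the sample sequence. *)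
primrec sseg ::
  "('s \<Rightarrow> 'a::real_vector \<Rightarrow> 'a) \<Rightarrow> ('s \<Rightarrow> real) \<Rightarrow> ('s \<Rightarrow> real) \<Rightarrow> 'a \<Rightarrow> (nat \<Rightarrow> 's) \<Rightarrow> nat \<Rightarrow> 'a"
where
  "sseg F \<gamma>1 \<gamma>2 x0 \<xi> 0 = x0"
| "sseg F \<gamma>1 \<gamma>2 x0 \<xi> (Suc k) =
     (let x = sseg F \<gamma>1 \<gamma>2 x0 \<xi> k; s = \<xi> k
      in x - \<gamma>2 s *\<^sub>R F s (x - \<gamma>1 s *\<^sub>R F s x))"

end

theory Submission
  imports Defs
begin

text \<open>
  Write \<open>z\<close> for the solution \<open>xstar\<close> and \<open>u = x - z\<close> for the current error. For one fixed sample
  put \<open>m = \<gamma>1 s * \<mu> s\<close>, \<open>A = \<gamma>1 s *\<^sub>R F s x\<close>, \<open>B = \<gamma>1 s *\<^sub>R F s (x - A)\<close> and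
  \<open>C = \<gamma>1 s *\<^sub>R F s z\<close>, so that the new error is \<open>u - \<alpha> *\<^sub>R B\<close>. The proof rests on the
  deterministic estimate \<open>extragradient_step_inequality\<close>,

    \<open>(norm (u - \<alpha> *\<^sub>R B))\<^sup>2 \<le> (1 - \<alpha> * w) * (norm u)\<^sup>2 - 2 * \<alpha> * (C \<bullet> u) + 3 * \<alpha> * (norm C)\<^sup>2\<close>,

  where \<open>w = min m (4 * m)\<close> is exactly \<open>m\<close> times the weight 1 or 4 of the stepsize condition.
  Quasi-monotonicity at the extrapolated point \<open>x - A\<close> yields the decrease; moving from \<open>x - A\<close>
  back to \<open>x\<close> costs a term \<open>4 * \<bar>m\<bar> * (norm A)\<^sup>2\<close>, and this is paid for by \<open>- 2 * (B \<bullet> A)\<close>,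
  which is nonpositive because the Lipschitz bound keeps \<open>B\<close> close to \<open>A\<close>.

  On averaging over a fresh sample the term linear in \<open>C\<close> vanishes, since \<open>C\<close> has mean zero, and
  \<open>\<alpha> * w\<close> averages to \<open>2 * \<rho>\<close> (\<open>nn_integral_seg_step_le\<close>). The current iterate is a function of
  the earlier samples only, so Fubini's theorem turns this into the recursion
  \<open>e (k + 1) \<le> (1 - 2 * \<rho>) * e k + 3 * \<alpha> * v\<close> for the mean squared errors \<open>e k\<close>, where \<open>v\<close> is the
  noise level. Unrolled, it gives the rate \<open>1 - 2 * \<rho>\<close> and the residual
  \<open>3 * \<alpha> * v / (2 * \<rho>)\<close>, both sharper than claimed. The measure-theoretic work is the joint
  measurability of a step in the sample and the point, which holds because each \<open>F s\<close> is
  continuous (\<open>measurable_pair_continuous\<close>).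
\<close>

section \<open>The estimate for one extragradient step\<close>

text \<open>
  Expand the square and split
  \<open>B \<bullet> u = (B - C) \<bullet> (u - A) + B \<bullet> A + C \<bullet> u - C \<bullet> A\<close>. Monotonicity bounds the first product;
  the polarisation identity shows that \<open>B \<bullet> A\<close> is large, because \<open>B - A\<close> is small; and \<open>C \<bullet> A\<close> is
  absorbed by Young's inequality. With \<open>r = 1 - 4 * \<bar>m\<bar>\<close> everything then depends on the coefficient
  of \<open>(norm A)\<^sup>2\<close> being nonpositive. When \<open>r\<close> is small, \<open>- (norm A)\<^sup>2\<close> is used up by the term
  \<open>4 * \<bar>m\<bar> * (norm A)\<^sup>2\<close>, and the term \<open>- (norm B)\<^sup>2\<close> of the polarisation identity is what remains
  to pay for \<open>C \<bullet> A\<close>.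
\<close>
lemma extragradient_step_inequality:
  fixes u A B C :: "'a::real_inner"
  assumes mono: "m * (norm (u - A))\<^sup>2 \<le> (B - C) \<bullet> (u - A)"
    and lip: "norm (B - A) \<le> l * norm A"
    and l: "0 \<le> l" "4 * \<bar>m\<bar> + sqrt 2 * l \<le> 1"
    and \<alpha>: "0 \<le> \<alpha>" "\<alpha> \<le> 1 / 4"
  shows "(norm (u - \<alpha> *\<^sub>R B))\<^sup>2
    \<le> (1 - \<alpha> * min m (4 * m)) * (norm u)\<^sup>2 - 2 * \<alpha> * (C \<bullet> u) + 3 * \<alpha> * (norm C)\<^sup>2"
proof -
  have sq: "(norm (B - A))\<^sup>2 \<le> l\<^sup>2 * (norm A)\<^sup>2"
    using power_mono[OF lip, of 2] by (simp add: power_mult_distrib)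
  define r where "r = 1 - 4 * \<bar>m\<bar>"
  have r: "0 \<le> r" "r \<le> 1"
    using l mult_nonneg_nonneg[of "sqrt 2" l] real_sqrt_ge_zero[of 2] unfolding r_def by linarith+
  have "sqrt 2 * l \<le> r" using l by (simp add: r_def)
  then have "(sqrt 2 * l)\<^sup>2 \<le> r\<^sup>2" using l by (intro power_mono) auto
  then have lr: "2 * l\<^sup>2 \<le> r\<^sup>2" by (simp add: power_mult_distrib)
  \<comment> \<open>This is the final balance of the coefficients of \<open>(norm A)\<^sup>2\<close>: \<open>half\<close> turns \<open>- 3/4 * (norm B)\<^sup>2\<close>
    into \<open>- 3/8 * (norm A)\<^sup>2 + 3/4 * (norm (B - A))\<^sup>2\<close>, so that \<open>7/4 = 1 + 3/4\<close>
    and \<open>1/24 = 3/8 - 1/3\<close>, with 1 from \<open>polar\<close> and \<open>1/3\<close> from \<open>young\<close>.\<close>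
  have quad: "7/4 * l\<^sup>2 \<le> r + 1/24"
  proof -
    have "r\<^sup>2 \<le> r" using r by (simp add: power2_eq_square mult_left_le)
    then show ?thesis using lr r by simp
  qed
  \<comment> \<open>The weight 4 appears here: \<open>(norm (u - A))\<^sup>2\<close> is at least half of \<open>(norm u)\<^sup>2\<close> up to an error, which
    serves \<open>0 \<le> m\<close>, and at most twice \<open>(norm u)\<^sup>2\<close> up to an error, which serves \<open>m < 0\<close>.\<close>
  have drift: "- 2 * m * (norm (u - A))\<^sup>2 \<le> - min m (4 * m) * (norm u)\<^sup>2 + 4 * \<bar>m\<bar> * (norm A)\<^sup>2"
  proof (cases "0 \<le> m")
    case True
    have "0 \<le> (norm (u - 2 *\<^sub>R A))\<^sup>2" by simp
    then have "(norm u)\<^sup>2 \<le> 2 * (norm (u - A))\<^sup>2 + 2 * (norm A)\<^sup>2"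
      by (simp add: power2_norm_eq_inner inner_diff_left inner_diff_right inner_commute)
    then have "m * (norm u)\<^sup>2 \<le> m * (2 * (norm (u - A))\<^sup>2 + 2 * (norm A)\<^sup>2)"
      using True by (rule mult_left_mono)
    then have "m * (norm u)\<^sup>2 \<le> 2 * (m * (norm (u - A))\<^sup>2) + 2 * (m * (norm A)\<^sup>2)"
      by (simp add: algebra_simps)
    moreover have "0 \<le> m * (norm A)\<^sup>2" using True by simp
    moreover have "min m (4 * m) = m" "4 * \<bar>m\<bar> * (norm A)\<^sup>2 = 4 * (m * (norm A)\<^sup>2)"
      using True by simp_all
    ultimately show ?thesis by linarith
  next
    case False
    have "0 \<le> (norm (u + A))\<^sup>2" by simp
    then have "(norm (u - A))\<^sup>2 \<le> 2 * (norm u)\<^sup>2 + 2 * (norm A)\<^sup>2"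
      by (simp add: power2_norm_eq_inner inner_simps inner_commute)
    then have "- m * (norm (u - A))\<^sup>2 \<le> - m * (2 * (norm u)\<^sup>2 + 2 * (norm A)\<^sup>2)"
      using False by (intro mult_left_mono) auto
    moreover have "min m (4 * m) = 4 * m" using False by simp
    ultimately show ?thesis using False by (simp add: algebra_simps)
  qed
  have young: "2 * (C \<bullet> A) \<le> 1/3 * (norm A)\<^sup>2 + 3 * (norm C)\<^sup>2"
  proof -
    have "0 \<le> (norm (A - 3 *\<^sub>R C))\<^sup>2" by simp
    then show ?thesis
      by (simp add: power2_norm_eq_inner inner_simps inner_commute)
  qed
  have half: "(norm A)\<^sup>2 \<le> 2 * (norm B)\<^sup>2 + 2 * (norm (B - A))\<^sup>2"
  proof -
    have "0 \<le> (norm (2 *\<^sub>R B - A))\<^sup>2" by simp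
    then show ?thesis
      by (simp add: power2_norm_eq_inner inner_simps inner_commute)
  qed
  have polar: "- 2 * (B \<bullet> A) = (norm (B - A))\<^sup>2 - (norm A)\<^sup>2 - (norm B)\<^sup>2"
    by (simp add: power2_norm_eq_inner inner_simps inner_commute)
  have aB: "\<alpha> * (norm B)\<^sup>2 \<le> 1/4 * (norm B)\<^sup>2"
    using \<alpha> by (intro mult_right_mono) auto
  have qA: "7/4 * (l\<^sup>2 * (norm A)\<^sup>2) \<le> r * (norm A)\<^sup>2 + 1/24 * (norm A)\<^sup>2"
    using mult_right_mono[OF quad, of "(norm A)\<^sup>2"] by (simp add: distrib_right)
  have rA: "4 * \<bar>m\<bar> * (norm A)\<^sup>2 = (norm A)\<^sup>2 - r * (norm A)\<^sup>2"
    by (simp add: r_def algebra_simps)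
  have split: "B \<bullet> u = (B - C) \<bullet> (u - A) + B \<bullet> A + C \<bullet> u - C \<bullet> A"
    by (simp add: inner_simps)
  have "- 2 * (B \<bullet> u) + \<alpha> * (norm B)\<^sup>2
      \<le> - min m (4 * m) * (norm u)\<^sup>2 - 2 * (C \<bullet> u) + 3 * (norm C)\<^sup>2"
    using mono drift young half polar aB qA rA split sq by linarith
  then have "\<alpha> * (- 2 * (B \<bullet> u) + \<alpha> * (norm B)\<^sup>2)
      \<le> \<alpha> * (- min m (4 * m) * (norm u)\<^sup>2 - 2 * (C \<bullet> u) + 3 * (norm C)\<^sup>2)"
    using \<alpha>(1) by (rule mult_left_mono)
  moreover have "(norm (u - \<alpha> *\<^sub>R B))\<^sup>2
      = (norm u)\<^sup>2 + \<alpha> * (- 2 * (B \<bullet> u) + \<alpha> * (norm B)\<^sup>2)"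
    by (simp only: power2_norm_eq_inner) (simp add: inner_simps inner_commute algebra_simps)
  ultimately show ?thesis by (simp add: algebra_simps)
qed

text \<open>The map applied by the iteration for one sample, separated so that measurability and
  integration can treat the sample and the point as independent arguments.\<close>

definition seg_step ::
  "('s \<Rightarrow> 'a::real_vector \<Rightarrow> 'a) \<Rightarrow> ('s \<Rightarrow> real) \<Rightarrow> ('s \<Rightarrow> real) \<Rightarrow> 's \<Rightarrow> 'a \<Rightarrow> 'a"
  where "seg_step F \<gamma>1 \<gamma>2 s x = x - \<gamma>2 s *\<^sub>R F s (x - \<gamma>1 s *\<^sub>R F s x)"

lemma sseg_Suc: "sseg F \<gamma>1 \<gamma>2 x0 \<xi> (Suc k) = seg_step F \<gamma>1 \<gamma>2 (\<xi> k) (sseg F \<gamma>1 \<gamma>2 x0 \<xi> k)"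
  by (simp add: seg_step_def Let_def)

text \<open>Independence enters through this fact: iterate \<open>k\<close> ignores sample \<open>k\<close> and all later ones.\<close>

lemma sseg_cong:
  assumes "\<And>i. i < k \<Longrightarrow> \<xi> i = \<xi>' i"
  shows "sseg F \<gamma>1 \<gamma>2 x0 \<xi> k = sseg F \<gamma>1 \<gamma>2 x0 \<xi>' k"
  using assms by (induction k) (simp_all add: Let_def)

text \<open>Scaling the operator by the stepsize \<open>\<gamma>1 s\<close> makes the quantities dimensionless: the
  monotonicity constant becomes \<open>\<gamma>1 s * \<mu>\<close>, the Lipschitz constant \<open>\<gamma>1 s * L\<close>, and the stepsize
  bound becomes the smallness condition of \<open>extragradient_step_inequality\<close>.\<close>

lemma seg_step_dist_le:
  fixes F :: "'s \<Rightarrow> 'a::real_inner \<Rightarrow> 'a"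
  assumes lip: "L-lipschitz_on UNIV (F s)" and L: "0 < L"
    and mono: "\<And>y. \<mu> * (norm (y - z))\<^sup>2 \<le> (F s y - F s z) \<bullet> (y - z)"
    and \<gamma>: "0 < \<gamma>1 s" "\<gamma>1 s \<le> 1 / (4 * \<bar>\<mu>\<bar> + sqrt 2 * L)" "\<gamma>2 s = \<alpha> * \<gamma>1 s"
    and \<alpha>: "0 \<le> \<alpha>" "\<alpha> \<le> 1 / 4"
  shows "(norm (seg_step F \<gamma>1 \<gamma>2 s x - z))\<^sup>2
    \<le> (1 - \<alpha> * min (\<gamma>1 s * \<mu>) (4 * (\<gamma>1 s * \<mu>))) * (norm (x - z))\<^sup>2
      - 2 * \<alpha> * ((\<gamma>1 s *\<^sub>R F s z) \<bullet> (x - z)) + 3 * \<alpha> * ((\<gamma>1 s)\<^sup>2 * (norm (F s z))\<^sup>2)"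
proof -
  define g where "g = \<gamma>1 s"
  define y where "y = x - g *\<^sub>R F s x"
  have g: "0 < g" using \<gamma> by (simp add: g_def)
  have "0 < 4 * \<bar>\<mu>\<bar> + sqrt 2 * L" using L by (intro add_nonneg_pos) auto
  then have "g * (4 * \<bar>\<mu>\<bar> + sqrt 2 * L) \<le> 1"
    using \<gamma>(2) by (simp add: g_def pos_le_divide_eq)
  then have small: "4 * \<bar>g * \<mu>\<bar> + sqrt 2 * (g * L) \<le> 1"
    using g by (simp add: abs_mult algebra_simps)
  have yz: "(x - z) - g *\<^sub>R F s x = y - z" by (simp add: y_def)
  have "norm (F s y - F s x) \<le> L * norm (y - x)"
    using lip by (auto simp: lipschitz_on_def dist_norm)
  also have "y - x = - (g *\<^sub>R F s x)" by (simp add: y_def)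
  finally have "g * norm (F s y - F s x) \<le> g * (L * norm (g *\<^sub>R F s x))"
    using g by (simp add: mult_left_mono)
  then have lipg: "norm (g *\<^sub>R F s y - g *\<^sub>R F s x) \<le> (g * L) * norm (g *\<^sub>R F s x)"
    using g by (simp add: scaleR_diff_right[symmetric] mult.assoc)
  have "(g * \<mu>) * (norm (y - z))\<^sup>2 \<le> (g *\<^sub>R F s y - g *\<^sub>R F s z) \<bullet> (y - z)"
    using mult_left_mono[OF mono[of y], of g] g
    by (simp add: scaleR_diff_right[symmetric] mult.assoc)
  then have monog: "(g * \<mu>) * (norm ((x - z) - g *\<^sub>R F s x))\<^sup>2
      \<le> (g *\<^sub>R F s y - g *\<^sub>R F s z) \<bullet> ((x - z) - g *\<^sub>R F s x)"
    unfolding yz .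
  have "seg_step F \<gamma>1 \<gamma>2 s x - z = (x - z) - \<alpha> *\<^sub>R (g *\<^sub>R F s y)"
    using \<gamma>(3) by (simp add: seg_step_def g_def y_def)
  moreover have "(norm (g *\<^sub>R F s z))\<^sup>2 = g\<^sup>2 * (norm (F s z))\<^sup>2"
    by (simp add: power_mult_distrib)
  ultimately show ?thesis
    using extragradient_step_inequality[OF monog lipg _ small \<alpha>] g L by (simp only: g_def) simp
qed

section \<open>Measurability of the iterates\<close>

text \<open>
  Functions that are measurable in the sample and continuous in the point (Caratheodory functions)
  are jointly measurable: replace the point by simple functions \<open>U i\<close> of it that converge pointwise
  to the identity. For each \<open>i\<close> only finitely many values of the point occur, so measurability in
  the sample suffices, and continuity lets \<open>i\<close> tend to infinity.
\<close>

lemma measurable_pair_continuous: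
  fixes f :: "'s \<Rightarrow> 'a::{metric_space, second_countable_topology} \<Rightarrow> 'b::metric_space"
  assumes meas: "\<And>x. (\<lambda>s. f s x) \<in> borel_measurable D"
    and cont: "\<And>s. s \<in> space D \<Longrightarrow> continuous_on UNIV (f s)"
  shows "(\<lambda>p. f (fst p) (snd p)) \<in> borel_measurable (D \<Otimes>\<^sub>M borel)"
proof -
  obtain U :: "nat \<Rightarrow> 'a \<Rightarrow> 'a" where simple: "\<And>i. simple_function borel (U i)"
    and lim: "\<And>x. (\<lambda>i. U i x) \<longlonglongrightarrow> x"
    using borel_measurable_implies_sequence_metric[of "\<lambda>x. x" borel undefined] by auto
  show ?thesis
  proof (rule borel_measurable_LIMSEQ_metric)
    fix i
    have fin: "finite (range (U i))"
      using simple[of i] by (auto simp: simple_function_def)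
    have "(\<lambda>p. U i (snd p)) \<in> D \<Otimes>\<^sub>M borel \<rightarrow>\<^sub>M count_space (range (U i))"
      using fin simple_functionD(2)[OF simple[of i]]
      by (intro measurable_compose[OF measurable_snd]) (auto simp: measurable_count_space_eq2)
    then show "(\<lambda>p. f (fst p) (U i (snd p))) \<in> borel_measurable (D \<Otimes>\<^sub>M borel)"
      by (rule measurable_compose_countable'[where f = "\<lambda>x p. f (fst p) x", rotated])
         (rule countable_finite[OF fin], rule measurable_compose[OF measurable_fst meas])
  next
    fix p :: "'s \<times> 'a" assume "p \<in> space (D \<Otimes>\<^sub>M borel)"
    then have "isCont (f (fst p)) (snd p)"
      using cont by (auto simp: space_pair_measure continuous_on_eq_continuous_at)
    then show "(\<lambda>i. f (fst p) (U i (snd p))) \<longlonglongrightarrow> f (fst p) (snd p)"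
      using lim by (rule isCont_tendsto_compose)
  qed
qed

lemma measurable_seg_step:
  fixes F :: "'s \<Rightarrow> 'a::euclidean_space \<Rightarrow> 'a"
  assumes F: "\<And>x. (\<lambda>s. F s x) \<in> borel_measurable D"
    and cont: "\<And>s. s \<in> space D \<Longrightarrow> continuous_on UNIV (F s)"
    and [measurable]: "\<gamma>1 \<in> borel_measurable D" "\<gamma>2 \<in> borel_measurable D"
    and [measurable]: "g \<in> N \<rightarrow>\<^sub>M D" "h \<in> borel_measurable N"
  shows "(\<lambda>\<omega>. seg_step F \<gamma>1 \<gamma>2 (g \<omega>) (h \<omega>)) \<in> borel_measurable N"
proof -
  note pair = measurable_pair_continuous[OF F cont]
  have [measurable]: "(\<lambda>\<omega>. F (g \<omega>) (k \<omega>)) \<in> borel_measurable N"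
    if [measurable]: "k \<in> borel_measurable N" for k
    using measurable_compose[OF _ pair, of "\<lambda>\<omega>. (g \<omega>, k \<omega>)" N] by simp
  show ?thesis unfolding seg_step_def by measurable
qed

lemma measurable_sseg:
  fixes F :: "'s \<Rightarrow> 'a::euclidean_space \<Rightarrow> 'a"
  assumes "\<And>x. (\<lambda>s. F s x) \<in> borel_measurable D"
    and "\<And>s. s \<in> space D \<Longrightarrow> continuous_on UNIV (F s)"
    and "\<gamma>1 \<in> borel_measurable D" "\<gamma>2 \<in> borel_measurable D"
    and "{..<k} \<subseteq> J"
  shows "(\<lambda>\<omega>. sseg F \<gamma>1 \<gamma>2 x0 \<omega> k) \<in> borel_measurable (PiM J (\<lambda>_. D))"
  using assms(5)
proof (induction k)
  case (Suc k)
  then have "k \<in> J" "(\<lambda>\<omega>. sseg F \<gamma>1 \<gamma>2 x0 \<omega> k) \<in> borel_measurable (PiM J (\<lambda>_. D))"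
    by (simp_all add: lessThan_Suc)
  then show ?case
    unfolding sseg_Suc
    by (intro measurable_seg_step[OF assms(1-4)] measurable_component_singleton[of k J "\<lambda>_. D"]) auto
qed simp

section \<open>Integrating out the next sample\<close>

lemma (in prob_space) nn_integral_indep_var:
  assumes ind: "indep_var S X T Y" and f: "f \<in> borel_measurable (S \<Otimes>\<^sub>M T)"
  shows "(\<integral>\<^sup>+ \<omega>. f (X \<omega>, Y \<omega>) \<partial>M) = (\<integral>\<^sup>+ \<omega>. (\<integral>\<^sup>+ t. f (X \<omega>, t) \<partial>distr M T Y) \<partial>M)"
proof -
  have [measurable]: "X \<in> M \<rightarrow>\<^sub>M S" "Y \<in> M \<rightarrow>\<^sub>M T"
    and joint: "distr M S X \<Otimes>\<^sub>M distr M T Y = distr M (S \<Otimes>\<^sub>M T) (\<lambda>\<omega>. (X \<omega>, Y \<omega>))"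
    using ind by (auto simp: indep_var_distribution_eq)
  interpret Y: prob_space "distr M T Y" by (rule prob_space_distr) simp
  have [measurable]: "f \<in> borel_measurable (S \<Otimes>\<^sub>M distr M T Y)"
    using f by simp
  have "(\<integral>\<^sup>+ \<omega>. f (X \<omega>, Y \<omega>) \<partial>M) = (\<integral>\<^sup>+ p. f p \<partial>(distr M S X \<Otimes>\<^sub>M distr M T Y))"
    unfolding joint using f by (subst nn_integral_distr) auto
  also have "\<dots> = (\<integral>\<^sup>+ x. (\<integral>\<^sup>+ t. f (x, t) \<partial>distr M T Y) \<partial>distr M S X)"
    using f by (intro Y.nn_integral_fst[symmetric]) simp
  also have "\<dots> = (\<integral>\<^sup>+ \<omega>. (\<integral>\<^sup>+ t. f (X \<omega>, t) \<partial>distr M T Y) \<partial>M)"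
    by (intro nn_integral_distr) auto
  finally show ?thesis .
qed

text \<open>
  This is conditioning on the past: given the first \<open>k\<close> samples, the next one still has law \<open>D\<close>.
  Independence of two variables requires a common type of values, so the next sample is
  first viewed as a family indexed by the singleton \<open>{k}\<close>.
\<close>

lemma (in prob_space) nn_integral_past_next_sample:
  fixes \<xi> :: "nat \<Rightarrow> 'a \<Rightarrow> 's"
  assumes ind: "indep_vars (\<lambda>_. D) \<xi> UNIV" and law: "distr M D (\<xi> k) = D"
    and h[measurable]: "h \<in> borel_measurable (PiM {..<k} (\<lambda>_. D) \<Otimes>\<^sub>M D)"
  shows "(\<integral>\<^sup>+ \<omega>. h (restrict (\<lambda>i. \<xi> i \<omega>) {..<k}, \<xi> k \<omega>) \<partial>M)
    = (\<integral>\<^sup>+ \<omega>. (\<integral>\<^sup>+ s. h (restrict (\<lambda>i. \<xi> i \<omega>) {..<k}, s) \<partial>D) \<partial>M)"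
proof -
  let ?P = "PiM {..<k} (\<lambda>_. D)" and ?N = "PiM {k} (\<lambda>_. D)"
  let ?X = "\<lambda>\<omega>. restrict (\<lambda>i. \<xi> i \<omega>) {..<k}" and ?Y = "\<lambda>\<omega>. restrict (\<lambda>i. \<xi> i \<omega>) {k}"
  have [measurable]: "\<xi> i \<in> M \<rightarrow>\<^sub>M D" for i
    using ind by (auto simp: indep_vars_def)
  have indep: "indep_var ?P ?X ?N ?Y"
    using indep_var_restrict[OF ind, of "{..<k}" "{k}"] by simp
  have [measurable]: "(\<lambda>t. t k) \<in> ?N \<rightarrow>\<^sub>M D"
    using measurable_component_singleton[of k "{k}" "\<lambda>_. D"] by simp
  have [measurable]: "?X \<in> M \<rightarrow>\<^sub>M ?P" "?Y \<in> M \<rightarrow>\<^sub>M ?N"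
    by (auto intro!: measurable_restrict)
  have "(\<integral>\<^sup>+ \<omega>. h (?X \<omega>, ?Y \<omega> k) \<partial>M)
      = (\<integral>\<^sup>+ \<omega>. (\<integral>\<^sup>+ t. h (?X \<omega>, t k) \<partial>distr M ?N ?Y) \<partial>M)"
    using nn_integral_indep_var[OF indep, of "\<lambda>p. h (fst p, snd p k)"] by simp
  also have "\<dots> = (\<integral>\<^sup>+ \<omega>. (\<integral>\<^sup>+ s. h (?X \<omega>, s) \<partial>distr M D (\<xi> k)) \<partial>M)"
  proof (rule nn_integral_cong)
    fix \<omega> assume "\<omega> \<in> space M"
    then have [measurable]: "(\<lambda>s. h (?X \<omega>, s)) \<in> borel_measurable D"
      using measurable_space[of ?X M ?P] by (intro measurable_compose[OF measurable_Pair1' h]) auto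
    have "(\<integral>\<^sup>+ t. h (?X \<omega>, t k) \<partial>distr M ?N ?Y) = (\<integral>\<^sup>+ \<omega>'. h (?X \<omega>, ?Y \<omega>' k) \<partial>M)"
      by (rule nn_integral_distr) measurable
    also have "\<dots> = (\<integral>\<^sup>+ s. h (?X \<omega>, s) \<partial>distr M D (\<xi> k))"
      by (subst nn_integral_distr) auto
    finally show "(\<integral>\<^sup>+ t. h (?X \<omega>, t k) \<partial>distr M ?N ?Y) = (\<integral>\<^sup>+ s. h (?X \<omega>, s) \<partial>distr M D (\<xi> k))" .
  qed
  finally show ?thesis by (simp add: law)
qed

text \<open>The cross term of \<open>seg_step_dist_le\<close> is linear in \<open>\<gamma>1 s *\<^sub>R F s z\<close>, whose mean is zero, so
  for a fixed point \<open>x\<close> only the drift and the noise survive the expectation.\<close>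

lemma nn_integral_seg_step_le:
  fixes F :: "'s \<Rightarrow> 'a::euclidean_space \<Rightarrow> 'a"
  assumes "prob_space D"
    and L: "\<And>s. s \<in> space D \<Longrightarrow> 0 < L s"
    and lip: "\<And>s. s \<in> space D \<Longrightarrow> (L s)-lipschitz_on UNIV (F s)"
    and mono: "\<And>s y. s \<in> space D \<Longrightarrow> \<mu> s * (norm (y - z))\<^sup>2 \<le> (F s y - F s z) \<bullet> (y - z)"
    and \<alpha>: "0 \<le> \<alpha>" "\<alpha> \<le> 1 / 4"
    and \<gamma>: "\<And>s. s \<in> space D \<Longrightarrow> \<gamma>2 s = \<alpha> * \<gamma>1 s" "\<And>s. s \<in> space D \<Longrightarrow> 0 < \<gamma>1 s"
      "\<And>s. s \<in> space D \<Longrightarrow> \<gamma>1 s \<le> 1 / (4 * \<bar>\<mu> s\<bar> + sqrt 2 * L s)"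
    and drift: "integrable D (\<lambda>s. min (\<gamma>1 s * \<mu> s) (4 * (\<gamma>1 s * \<mu> s)))"
    and bias: "integrable D (\<lambda>s. \<gamma>1 s *\<^sub>R F s z)" "(LINT s|D. \<gamma>1 s *\<^sub>R F s z) = 0"
    and noise: "integrable D (\<lambda>s. (\<gamma>1 s)\<^sup>2 * (norm (F s z))\<^sup>2)"
  shows "(\<integral>\<^sup>+ s. ennreal ((norm (seg_step F \<gamma>1 \<gamma>2 s x - z))\<^sup>2) \<partial>D)
    \<le> ennreal ((1 - \<alpha> * (LINT s|D. min (\<gamma>1 s * \<mu> s) (4 * (\<gamma>1 s * \<mu> s)))) * (norm (x - z))\<^sup>2
      + 3 * \<alpha> * (LINT s|D. (\<gamma>1 s)\<^sup>2 * (norm (F s z))\<^sup>2))"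
proof -
  interpret prob_space D by fact
  let ?R = "\<lambda>s. (1 - \<alpha> * min (\<gamma>1 s * \<mu> s) (4 * (\<gamma>1 s * \<mu> s))) * (norm (x - z))\<^sup>2
      - 2 * \<alpha> * ((\<gamma>1 s *\<^sub>R F s z) \<bullet> (x - z)) + 3 * \<alpha> * ((\<gamma>1 s)\<^sup>2 * (norm (F s z))\<^sup>2)"
  have step: "(norm (seg_step F \<gamma>1 \<gamma>2 s x - z))\<^sup>2 \<le> ?R s" if "s \<in> space D" for s
    using that L lip mono \<gamma> by (intro seg_step_dist_le[OF _ _ _ _ _ _ \<alpha>]) auto
  have int: "integrable D (\<lambda>s. (\<gamma>1 s *\<^sub>R F s z) \<bullet> (x - z))"
    using bias(1) by (rule integrable_inner_left)
  have int0: "(LINT s|D. (\<gamma>1 s *\<^sub>R F s z) \<bullet> (x - z)) = 0"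
    using bias by (subst integral_inner_left) auto
  have intR: "integrable D ?R"
    using drift int noise by auto
  have "(\<integral>\<^sup>+ s. ennreal ((norm (seg_step F \<gamma>1 \<gamma>2 s x - z))\<^sup>2) \<partial>D) \<le> (\<integral>\<^sup>+ s. ennreal (?R s) \<partial>D)"
    by (intro nn_integral_mono ennreal_leI step)
  also have "\<dots> = ennreal (LINT s|D. ?R s)"
    using intR order_trans[OF zero_le_power2 step]
    by (intro nn_integral_eq_integral AE_I2) blast+
  also have "(LINT s|D. ?R s) = (1 - \<alpha> * (LINT s|D. min (\<gamma>1 s * \<mu> s) (4 * (\<gamma>1 s * \<mu> s)))) * (norm (x - z))\<^sup>2
      + 3 * \<alpha> * (LINT s|D. (\<gamma>1 s)\<^sup>2 * (norm (F s z))\<^sup>2)"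
    using drift int noise int0 by (simp add: prob_space)
  finally show ?thesis .
qed

section \<open>Convergence\<close>

text \<open>The additive term is written as \<open>(1 - q) * b\<close> because then \<open>b\<close> is the fixed point of the
  recursion, and the excess of the sequence over \<open>b\<close> decays geometrically.\<close>

lemma geometric_recursion_bound:
  fixes e :: "nat \<Rightarrow> ennreal" and q b c :: real
  assumes step: "\<And>k. e (Suc k) \<le> ennreal q * e k + ennreal ((1 - q) * b)"
    and init: "e 0 \<le> ennreal c" and "0 \<le> q" "q \<le> 1" "0 \<le> b" "0 \<le> c"
  shows "e k \<le> ennreal (q ^ k * c + b)"
proof (induction k)
  case 0
  have "ennreal c \<le> ennreal (q ^ 0 * c + b)"
    using assms(5) by (intro ennreal_leI) simp
  with init show ?case by (rule order_trans)
next
  case (Suc k)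
  have "e (Suc k) \<le> ennreal q * ennreal (q ^ k * c + b) + ennreal ((1 - q) * b)"
    using step[of k] Suc.IH by (meson add_right_mono mult_left_mono order_trans zero_le)
  also have "\<dots> = ennreal (q * (q ^ k * c + b) + (1 - q) * b)"
    using assms(3-6) by (simp add: ennreal_mult ennreal_plus)
  also have "q * (q ^ k * c + b) + (1 - q) * b = q ^ Suc k * c + b"
    by (simp add: algebra_simps)
  finally show ?case .
qed

text \<open>The indicator weights choose the worse of the two factors 1 and 4, hence a minimum, which is
  the form in which the drift arises in \<open>extragradient_step_inequality\<close>.\<close>

lemma curvature_weight_eq_min:
  fixes m \<gamma> :: real
  assumes "0 < \<gamma>"
  shows "\<gamma> * m * (of_bool (0 \<le> m) + 4 * of_bool (m < 0)) = min (\<gamma> * m) (4 * (\<gamma> * m))"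
  using assms by (auto simp: min_def mult_le_0_iff zero_le_mult_iff)

theorem theorem3p1:
  fixes F :: "real ^ 'd \<Rightarrow> real ^ 'd"
    and F\<xi> :: "'s \<Rightarrow> real ^ 'd \<Rightarrow> real ^ 'd"
    and D :: "'s measure"
    and M :: "'w measure"
    and \<xi> :: "nat \<Rightarrow> 'w \<Rightarrow> 's"
    and L \<mu> \<gamma>1 \<gamma>2 :: "'s \<Rightarrow> real"
    and \<alpha> \<rho> :: real
    and \<sigma>AS2 :: ennreal
    and x0 xstar :: "real ^ 'd"
    and K :: nat
  assumes "F xstar = 0"
    and "prob_space D"
    and "prob_space M"
    and "prob_space.indep_vars M (\<lambda>_. D) \<xi> UNIV"
    and "\<And>k. distr M D (\<xi> k) = D"
    and "\<And>x. (\<lambda>s. F\<xi> s x) \<in> borel_measurable D"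
    and "\<mu> \<in> borel_measurable D"
    and "\<gamma>1 \<in> borel_measurable D"
    and "\<And>s. s \<in> space D \<Longrightarrow> L s > 0"
    and "\<And>s. s \<in> space D \<Longrightarrow> (L s)-lipschitz_on UNIV (F\<xi> s)"
    and "\<And>s x. s \<in> space D \<Longrightarrow>
           (F\<xi> s x - F\<xi> s xstar) \<bullet> (x - xstar) \<ge> \<mu> s * (norm (x - xstar))\<^sup>2"
    and "0 < \<alpha>" and "\<alpha> \<le> 1 / 4"
    and "\<And>s. s \<in> space D \<Longrightarrow> \<gamma>2 s = \<alpha> * \<gamma>1 s"
    and "\<And>s. s \<in> space D \<Longrightarrow> \<gamma>1 s > 0"
    and "\<And>s. s \<in> space D \<Longrightarrow> \<gamma>1 s \<le> 1 / (4 * \<bar>\<mu> s\<bar> + sqrt 2 * L s)"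
    and "integrable D (\<lambda>s. \<gamma>1 s *\<^sub>R F\<xi> s xstar)"
    and "(LINT s|D. \<gamma>1 s *\<^sub>R F\<xi> s xstar) = 0"
    and "(LINT s|D. \<gamma>1 s * \<mu> s * (of_bool (\<mu> s \<ge> 0) + 4 * of_bool (\<mu> s < 0))) \<ge> 0"
    and "\<rho> = \<alpha> / 2 * (LINT s|D. \<gamma>1 s * \<mu> s * (of_bool (\<mu> s \<ge> 0) + 4 * of_bool (\<mu> s < 0)))"
    and "\<sigma>AS2 = (\<integral>\<^sup>+ s. ennreal ((\<gamma>1 s)\<^sup>2 * (norm (F\<xi> s xstar))\<^sup>2) \<partial>D)"
    and "\<rho> > 0"
  shows "(\<integral>\<^sup>+ \<omega>. ennreal ((norm (sseg F\<xi> \<gamma>1 \<gamma>2 x0 (\<lambda>k. \<xi> k \<omega>) K - xstar))\<^sup>2) \<partial>M)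
           \<le> ennreal ((1 - \<rho>) ^ K * (norm (x0 - xstar))\<^sup>2)
             + ennreal (3 * \<alpha> * (4 * \<alpha> + 1) / (2 * \<rho>)) * \<sigma>AS2"
proof -
  interpret D: prob_space D by fact
  interpret M: prob_space M by fact
  note [measurable] = assms(7,8)
  have cont: "continuous_on UNIV (F\<xi> s)" if "s \<in> space D" for s
    using assms(10)[OF that] by (rule lipschitz_on_continuous_on)
  have F_meas [measurable]: "(\<lambda>s. F\<xi> s x) \<in> borel_measurable D" for x
    by (rule assms(6))
  have \<gamma>2_meas: "\<gamma>2 \<in> borel_measurable D"
    using assms(14) by (subst measurable_cong[of D \<gamma>2 "\<lambda>s. \<alpha> * \<gamma>1 s"]) auto
  note meas = F_meas cont assms(8) \<gamma>2_meas

  define w where "w s = min (\<gamma>1 s * \<mu> s) (4 * (\<gamma>1 s * \<mu> s))" for s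
  have weight: "(LINT s|D. \<gamma>1 s * \<mu> s * (of_bool (\<mu> s \<ge> 0) + 4 * of_bool (\<mu> s < 0))) = (LINT s|D. w s)"
    using assms(15) by (intro Bochner_Integration.integral_cong refl) (simp add: w_def curvature_weight_eq_min)
  have \<rho>: "\<alpha> * (LINT s|D. w s) = 2 * \<rho>"
    using assms(20) weight by simp
  \<comment> \<open>A function that is not integrable has integral 0, which \<open>\<rho> > 0\<close> excludes.\<close>
  have w_int: "integrable D w"
    using \<rho> \<open>\<rho> > 0\<close> not_integrable_integral_eq[of D w] by fastforce
  \<comment> \<open>The stepsize bound makes \<open>w\<close> bounded, so that \<open>1 - 2 * \<rho>\<close> is a nonnegative contraction factor.\<close>
  have w_le: "w s \<le> 1" if s: "s \<in> space D" for s
  proof -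
    have "0 < 4 * \<bar>\<mu> s\<bar> + sqrt 2 * L s"
      using assms(9)[OF s] by (intro add_nonneg_pos) auto
    then have "\<gamma>1 s * (4 * \<bar>\<mu> s\<bar> + sqrt 2 * L s) \<le> 1"
      using assms(16)[OF s] by (simp add: pos_le_divide_eq)
    moreover have "\<gamma>1 s * \<mu> s \<le> \<gamma>1 s * (4 * \<bar>\<mu> s\<bar> + sqrt 2 * L s)"
      using assms(9)[OF s] assms(15)[OF s]
      by (intro mult_left_mono) (auto intro: order_trans[of _ "4 * \<bar>\<mu> s\<bar>"])
    ultimately show ?thesis by (simp add: w_def)
  qed
  have "(LINT s|D. w s) \<le> (LINT s|D. 1)"
    using w_int w_le by (intro integral_mono) auto
  then have "\<alpha> * (LINT s|D. w s) \<le> 1 / 4 * 1"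
    using assms(12,13) weight assms(19) by (intro mult_mono) (auto simp: D.prob_space)
  then have \<rho>_le: "2 * \<rho> \<le> 1" using \<rho> by simp

  show ?thesis
  proof (cases "\<sigma>AS2 = \<infinity>")
    case True
    have "0 < 3 * \<alpha> * (4 * \<alpha> + 1) / (2 * \<rho>)"
      using assms(12,22) by simp
    then have "ennreal (3 * \<alpha> * (4 * \<alpha> + 1) / (2 * \<rho>)) * \<sigma>AS2 = top"
      unfolding True by (metis ennreal_eq_0_iff ennreal_mult_top infinity_ennreal_def not_le)
    then show ?thesis by simp
  next
    case False
    have noise: "integrable D (\<lambda>s. (\<gamma>1 s)\<^sup>2 * (norm (F\<xi> s xstar))\<^sup>2)"
    proof (rule integrableI_nonneg)
      show "(\<lambda>s. (\<gamma>1 s)\<^sup>2 * (norm (F\<xi> s xstar))\<^sup>2) \<in> borel_measurable D"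
        by measurable
    qed (use False assms(21) in \<open>simp_all add: less_top\<close>)
    define v where "v = (LINT s|D. (\<gamma>1 s)\<^sup>2 * (norm (F\<xi> s xstar))\<^sup>2)"
    have v: "\<sigma>AS2 = ennreal v" "0 \<le> v"
      using nn_integral_eq_integral[OF noise] unfolding assms(21) v_def by simp_all
    define X where "X k \<omega> = sseg F\<xi> \<gamma>1 \<gamma>2 x0 (\<lambda>i. \<xi> i \<omega>) k" for k \<omega>
    define e where "e k = (\<integral>\<^sup>+ \<omega>. ennreal ((norm (X k \<omega> - xstar))\<^sup>2) \<partial>M)" for k
    \<comment> \<open>The fixed point of \<open>t \<mapsto> (1 - 2 * \<rho>) * t + 3 * \<alpha> * v\<close>.\<close>
    define b where "b = 3 * \<alpha> * v / (2 * \<rho>)"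
    have b: "0 \<le> b" "(1 - (1 - 2 * \<rho>)) * b = 3 * \<alpha> * v"
      using assms(12,22) v(2) by (simp_all add: b_def)
    have \<xi>_meas: "\<xi> i \<in> M \<rightarrow>\<^sub>M D" for i
      using assms(4) by (auto simp: M.indep_vars_def)
    have past: "(\<lambda>\<omega>. X k \<omega>) = (\<lambda>\<omega>. sseg F\<xi> \<gamma>1 \<gamma>2 x0 (restrict (\<lambda>i. \<xi> i \<omega>) {..<k}) k)" for k
      unfolding X_def by (intro ext sseg_cong) simp
    have X_meas [measurable]: "X k \<in> borel_measurable M" for k
      unfolding past
      by (rule measurable_compose[OF measurable_restrict measurable_sseg[OF meas order_refl]])
         (simp add: \<xi>_meas)

    have step: "e (Suc k) \<le> ennreal (1 - 2 * \<rho>) * e k + ennreal ((1 - (1 - 2 * \<rho>)) * b)" for k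
    proof -
      let ?h = "\<lambda>p. ennreal ((norm (seg_step F\<xi> \<gamma>1 \<gamma>2 (snd p) (sseg F\<xi> \<gamma>1 \<gamma>2 x0 (fst p) k) - xstar))\<^sup>2)"
      have [measurable]: "(\<lambda>p. seg_step F\<xi> \<gamma>1 \<gamma>2 (snd p) (sseg F\<xi> \<gamma>1 \<gamma>2 x0 (fst p) k))
          \<in> borel_measurable (PiM {..<k} (\<lambda>_. D) \<Otimes>\<^sub>M D)"
        by (intro measurable_seg_step[OF meas] measurable_snd
            measurable_compose[OF measurable_fst measurable_sseg[OF meas order_refl]])
      have h: "?h \<in> borel_measurable (PiM {..<k} (\<lambda>_. D) \<Otimes>\<^sub>M D)"
        by measurable
      have past\<omega>: "sseg F\<xi> \<gamma>1 \<gamma>2 x0 (restrict (\<lambda>i. \<xi> i \<omega>) {..<k}) k = X k \<omega>" for \<omega>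
        using past[of k] by metis
      have next_iterate: "X (Suc k) \<omega> = seg_step F\<xi> \<gamma>1 \<gamma>2 (\<xi> k \<omega>) (X k \<omega>)" for \<omega>
        by (simp only: X_def sseg_Suc)
      have "e (Suc k)
          = (\<integral>\<^sup>+ \<omega>. (\<integral>\<^sup>+ s. ennreal ((norm (seg_step F\<xi> \<gamma>1 \<gamma>2 s (X k \<omega>) - xstar))\<^sup>2) \<partial>D) \<partial>M)"
        using M.nn_integral_past_next_sample[OF assms(4,5) h]
        by (simp only: e_def past\<omega> next_iterate fst_conv snd_conv)
      also have "\<dots> \<le> (\<integral>\<^sup>+ \<omega>. ennreal ((1 - 2 * \<rho>) * (norm (X k \<omega> - xstar))\<^sup>2 + 3 * \<alpha> * v) \<partial>M)"
        using nn_integral_seg_step_le[OF assms(2,9,10,11) _ assms(13,14,15,16) _ assms(17,18) noise]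
          assms(12) w_int
        by (intro nn_integral_mono) (simp add: \<rho> w_def[abs_def, symmetric] v_def)
      also have "\<dots> = ennreal (1 - 2 * \<rho>) * e k + ennreal (3 * \<alpha> * v)"
        unfolding e_def using \<rho>_le assms(12) v(2)
        by (simp add: ennreal_plus ennreal_mult nn_integral_add nn_integral_cmult M.emeasure_space_1)
      finally show ?thesis by (simp only: b)
    qed
    have init: "e 0 \<le> ennreal ((norm (x0 - xstar))\<^sup>2)"
      by (simp add: e_def X_def M.emeasure_space_1)
    have "e K \<le> ennreal ((1 - 2 * \<rho>) ^ K * (norm (x0 - xstar))\<^sup>2 + b)"
      using \<rho>_le assms(22) b(1) by (intro geometric_recursion_bound[OF step init]) auto
    also have "\<dots> \<le> ennreal ((1 - \<rho>) ^ K * (norm (x0 - xstar))\<^sup>2 + 3 * \<alpha> * (4 * \<alpha> + 1) / (2 * \<rho>) * v)"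
    proof (intro ennreal_leI add_mono mult_right_mono power_mono)
      show "b \<le> 3 * \<alpha> * (4 * \<alpha> + 1) / (2 * \<rho>) * v"
        using assms(12,22) v(2) by (simp add: b_def field_simps)
    qed (use \<rho>_le assms(22) in auto)
    also have "\<dots> = ennreal ((1 - \<rho>) ^ K * (norm (x0 - xstar))\<^sup>2)
        + ennreal (3 * \<alpha> * (4 * \<alpha> + 1) / (2 * \<rho>)) * \<sigma>AS2"
      using \<rho>_le assms(12,22) v by (simp add: ennreal_plus ennreal_mult[symmetric])
    finally show ?thesis by (simp add: e_def X_def)
  qed
qed

end
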